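(* Let $E$ be an integral lattice, let $h\in O(E)$ have order $n$, and let $M=\{(x,x)\mid x\in E\}$, $N=\{(x,hx)\mid x\in E\}$ and $L=M+N\subseteq E\perp E$. Then $O(L)$ contains a chain of subgroups $\langle t_M,t_N\rangle\le W_{M,N}\cong \mathbb{Z}_n\wr\mathbb{Z}_2$. Furthermore, each of $t_M$, $t_N$ is a wreathing involution of $W_{M,N}$.
   Context: A lattice is a finitely generated free abelian group with a rational valued symmetric bilinear form; it is integral if the form takes integer values. $O(E)$ is the group of isometries of $E$, and $E\perp E$ is the orthogonal direct sum of two copies of $E$. For $X=M$ or $N$, $t_X$ is the orthogonal transformation which is $-1$ on $X$ and $1$ on the annihilator $ann(X)$ of $X$; explicitly, as maps on $E\perp E$, $t_M:(x,y)\mapsto(-y,-x)$ and $t_N:(x,y)\mapsto(-h^{-1}y,-hx)$. These maps take $L$ to itself, and in the claim $t_M,t_N$ denote their restrictions to $L$. $\mathbb{Z}_n\wr\mathbb{Z}_2$ is the wreath product $(\mathbb{Z}_n\times\mathbb{Z}_n)\rtimes\mathbb{Z}_2$ in which $\mathbb{Z}_2$ swaps the two factors; a wreathing involution is an element of order 2 outside the base group $\mathbb{Z}_n\times\mathbb{Z}_n$, whose conjugation action interchanges the two direct factors.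
   Formalization: The lattice E is assumed to be nonzero: for E = 0 one has h = 1 and n = 1, and O(L) is trivial, so it cannot contain a copy of the wreath product of Z_1 with Z_2, which has order 2. *)

theory Defs
  imports "HOL-Algebra.Algebra" "HOL-Library.Product_Plus" "HOL-Library.Set_Algebras"
begin

section \<open>Lattices and their isometry groups\<close>

definition additive_group :: "'a::ab_group_add set \<Rightarrow> 'a monoid" where
  "additive_group E = \<lparr>carrier = E, monoid.mult = (+), one = 0\<rparr>"

text \<open>The form is a function on the ambient type, but only its values on \<open>E\<close> matter.
  Degenerate and indefinite forms are allowed.\<close>

locale rational_lattice =
  fixes E :: "'a::ab_group_add set" and f :: "'a \<Rightarrow> 'a \<Rightarrow> rat"
  assumes comm_group: "comm_group (additive_group E)"
    and free_fin_rank: "\<exists>r::nat. additive_group E \<cong> free_Abelian_group {..<r}"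
    and form_sym: "\<lbrakk>x \<in> E; y \<in> E\<rbrakk> \<Longrightarrow> f x y = f y x"
    and form_add: "\<lbrakk>x \<in> E; y \<in> E; z \<in> E\<rbrakk> \<Longrightarrow> f (x + y) z = f x z + f y z"

locale integral_lattice = rational_lattice +
  assumes form_integral: "\<lbrakk>x \<in> E; y \<in> E\<rbrakk> \<Longrightarrow> f x y \<in> \<int>"

text \<open>Elements of the isometry group are extensional, i.e. \<open>undefined\<close> outside \<open>E\<close>,
  as everywhere in \<^theory>\<open>HOL-Algebra.Bij\<close>.\<close>

definition isometry_group ::
  "'a::ab_group_add set \<Rightarrow> ('a \<Rightarrow> 'a \<Rightarrow> rat) \<Rightarrow> ('a \<Rightarrow> 'a) monoid" where
  "isometry_group E f = AutoGroup (additive_group E)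
     \<lparr>carrier := {g \<in> carrier (AutoGroup (additive_group E)).
                  \<forall>x\<in>E. \<forall>y\<in>E. f (g x) (g y) = f x y}\<rparr>"

definition perp_form ::
  "('a \<Rightarrow> 'a \<Rightarrow> rat) \<Rightarrow> ('b \<Rightarrow> 'b \<Rightarrow> rat) \<Rightarrow> 'a \<times> 'b \<Rightarrow> 'a \<times> 'b \<Rightarrow> rat" where
  "perp_form f g = (\<lambda>(x, y) (x', y'). f x x' + g y y')"

definition annihilator :: "'a set \<Rightarrow> ('a \<Rightarrow> 'a \<Rightarrow> rat) \<Rightarrow> 'a set \<Rightarrow> 'a set" where
  "annihilator E f S = {v \<in> E. \<forall>x\<in>S. f v x = 0}"


section \<open>The sublattices \<open>M\<close>, \<open>N\<close>, \<open>L\<close> of \<open>E \<bottom> E\<close> and the maps \<open>t\<^sub>M\<close>, \<open>t\<^sub>N\<close>\<close>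

definition lat_M :: "'a set \<Rightarrow> ('a \<times> 'a) set" where
  "lat_M E = {(x, x) | x. x \<in> E}"

definition lat_N :: "'a set \<Rightarrow> ('a \<Rightarrow> 'a) \<Rightarrow> ('a \<times> 'a) set" where
  "lat_N E h = {(x, h x) | x. x \<in> E}"

text \<open>The sum is the elementwise sum of sets.\<close>

definition lat_L :: "'a::ab_group_add set \<Rightarrow> ('a \<Rightarrow> 'a) \<Rightarrow> ('a \<times> 'a) set" where
  "lat_L E h = lat_M E + lat_N E h"

definition t_M :: "'a::ab_group_add \<times> 'a \<Rightarrow> 'a \<times> 'a" where
  "t_M = (\<lambda>(x, y). (- y, - x))"

definition t_N ::
  "'a::ab_group_add set \<Rightarrow> ('a \<Rightarrow> 'a \<Rightarrow> rat) \<Rightarrow> ('a \<Rightarrow> 'a) \<Rightarrow> 'a \<times> 'a \<Rightarrow> 'a \<times> 'a" where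
  "t_N E f h = (\<lambda>(x, y). (- (inv\<^bsub>isometry_group E f\<^esub> h) y, - h x))"


section \<open>The wreath product \<open>G \<wr> \<int>\<^sub>2\<close>\<close>

definition semidirect_product ::
  "('a, 'c) monoid_scheme \<Rightarrow> ('b, 'd) monoid_scheme \<Rightarrow> ('b \<Rightarrow> 'a \<Rightarrow> 'a) \<Rightarrow> ('a \<times> 'b) monoid" where
  "semidirect_product N H \<alpha> =
     \<lparr>carrier = carrier N \<times> carrier H,
      monoid.mult = (\<lambda>(a, s) (b, t). (a \<otimes>\<^bsub>N\<^esub> \<alpha> s b, s \<otimes>\<^bsub>H\<^esub> t)),
      one = (\<one>\<^bsub>N\<^esub>, \<one>\<^bsub>H\<^esub>)\<rparr>"

definition wreath_Z2 :: "('a, 'c) monoid_scheme \<Rightarrow> (('a \<times> 'a) \<times> int) monoid" where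
  "wreath_Z2 G = semidirect_product (G \<times>\<times> G) (integer_mod_group 2)
     (\<lambda>s. if s = 0 then id else prod.swap)"

definition first_factor :: "('a, 'c) monoid_scheme \<Rightarrow> (('a \<times> 'a) \<times> int) set" where
  "first_factor G = {((a, \<one>\<^bsub>G\<^esub>), 0) | a. a \<in> carrier G}"

definition second_factor :: "('a, 'c) monoid_scheme \<Rightarrow> (('a \<times> 'a) \<times> int) set" where
  "second_factor G = {((\<one>\<^bsub>G\<^esub>, a), 0) | a. a \<in> carrier G}"

definition base_group :: "('a, 'c) monoid_scheme \<Rightarrow> (('a \<times> 'a) \<times> int) set" where
  "base_group G = {((a, b), 0) | a b. a \<in> carrier G \<and> b \<in> carrier G}"

definition wreathing_involution ::
  "('a, 'c) monoid_scheme \<Rightarrow> ('a \<times> 'a) \<times> int \<Rightarrow> bool" where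
  "wreathing_involution G t \<longleftrightarrow>
     t \<in> carrier (wreath_Z2 G) \<and> group.ord (wreath_Z2 G) t = 2 \<and> t \<notin> base_group G \<and>
     (\<lambda>g. t \<otimes>\<^bsub>wreath_Z2 G\<^esub> g \<otimes>\<^bsub>wreath_Z2 G\<^esub> inv\<^bsub>wreath_Z2 G\<^esub> t) ` first_factor G = second_factor G \<and>
     (\<lambda>g. t \<otimes>\<^bsub>wreath_Z2 G\<^esub> g \<otimes>\<^bsub>wreath_Z2 G\<^esub> inv\<^bsub>wreath_Z2 G\<^esub> t) ` second_factor G = first_factor G"


section \<open>Sanity checks\<close>

lemma group_isometry_group:
  assumes "comm_group (additive_group E)"
  shows "group (isometry_group E f)"
proof -
  interpret A: comm_group "additive_group E" by fact
  interpret G: group "AutoGroup (additive_group E)" by (rule A.AutoGroup)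
  let ?C = "carrier (isometry_group E f)"
  have carr: "carrier (additive_group E) = E" by (simp add: additive_group_def)
  have autD: "g \<in> Bij E" if "g \<in> carrier (AutoGroup (additive_group E))" for g
    using that by (simp add: AutoGroup_def auto_def carr)
  have mult: "g \<otimes>\<^bsub>AutoGroup (additive_group E)\<^esub> k = compose E g k"
    if "g \<in> Bij E" "k \<in> Bij E" for g k
    using that by (simp add: AutoGroup_def BijGroup_def carr)
  have one: "\<one>\<^bsub>AutoGroup (additive_group E)\<^esub> = (\<lambda>x\<in>E. x)"
    by (simp add: AutoGroup_def BijGroup_def carr)
  have "subgroup ?C (AutoGroup (additive_group E))"
  proof (rule G.subgroupI)
    show "?C \<subseteq> carrier (AutoGroup (additive_group E))"
      by (auto simp: isometry_group_def)
    have "(\<lambda>x\<in>E. x) \<in> ?C"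
      using G.one_closed by (simp add: isometry_group_def one)
    then show "?C \<noteq> {}" by blast
  next
    fix g assume g: "g \<in> ?C"
    let ?A = "AutoGroup (additive_group E)"
    have gA: "g \<in> carrier ?A" and gf: "\<And>x y. \<lbrakk>x \<in> E; y \<in> E\<rbrakk> \<Longrightarrow> f (g x) (g y) = f x y"
      using g by (auto simp: isometry_group_def)
    have iA: "inv\<^bsub>?A\<^esub> g \<in> carrier ?A" using gA by simp
    have "compose E g (inv\<^bsub>?A\<^esub> g) = (\<lambda>x\<in>E. x)"
      using G.r_inv[OF gA] mult[OF autD[OF gA] autD[OF iA]] one by simp
    then have gi: "g ((inv\<^bsub>?A\<^esub> g) x) = x" if "x \<in> E" for x
      using that by (metis compose_eq restrict_apply')
    have mem: "(inv\<^bsub>?A\<^esub> g) x \<in> E" if "x \<in> E" for x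
      using Bij_imp_funcset[OF autD[OF iA]] that by auto
    have "f ((inv\<^bsub>?A\<^esub> g) x) ((inv\<^bsub>?A\<^esub> g) y) = f x y" if "x \<in> E" "y \<in> E" for x y
      using gf[OF mem[OF that(1)] mem[OF that(2)]] gi that by simp
    then show "inv\<^bsub>?A\<^esub> g \<in> ?C" using iA by (simp add: isometry_group_def)
  next
    fix g k assume g: "g \<in> ?C" and k: "k \<in> ?C"
    let ?A = "AutoGroup (additive_group E)"
    have gA: "g \<in> carrier ?A" and kA: "k \<in> carrier ?A"
      using g k by (auto simp: isometry_group_def)
    have "k x \<in> E" if "x \<in> E" for x
      using Bij_imp_funcset[OF autD[OF kA]] that by auto
    then have "f (compose E g k x) (compose E g k y) = f x y" if "x \<in> E" "y \<in> E" for x y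
      using g k that by (simp add: isometry_group_def compose_eq)
    then show "g \<otimes>\<^bsub>?A\<^esub> k \<in> ?C"
      using G.m_closed[OF gA kA] mult[OF autD[OF gA] autD[OF kA]]
      by (simp add: isometry_group_def)
  qed
  then have "group (AutoGroup (additive_group E)\<lparr>carrier := ?C\<rparr>)"
    by (rule G.subgroup_imp_group)
  then show ?thesis by (simp add: isometry_group_def)
qed

lemma isometry_group_inv:
  assumes "comm_group (additive_group E)" "h \<in> carrier (isometry_group E f)" "x \<in> E"
  shows "(inv\<^bsub>isometry_group E f\<^esub> h) x \<in> E"
    "h ((inv\<^bsub>isometry_group E f\<^esub> h) x) = x" "(inv\<^bsub>isometry_group E f\<^esub> h) (h x) = x"
proof -
  interpret G: group "isometry_group E f" using assms(1) by (rule group_isometry_group)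
  have carr: "carrier (additive_group E) = E" by (simp add: additive_group_def)
  let ?i = "inv\<^bsub>isometry_group E f\<^esub> h"
  have iso: "?i \<in> carrier (isometry_group E f)" using assms(2) by simp
  have bij: "h \<in> Bij E" "?i \<in> Bij E"
    using assms(2) iso by (auto simp: isometry_group_def AutoGroup_def auto_def carr)
  then show "?i x \<in> E" using Bij_imp_funcset assms(3) by blast
  have "compose E h ?i = (\<lambda>x\<in>E. x)" "compose E ?i h = (\<lambda>x\<in>E. x)"
    using G.r_inv[OF assms(2)] G.l_inv[OF assms(2)] bij
    by (simp_all add: isometry_group_def AutoGroup_def BijGroup_def carr)
  then show "h (?i x) = x" "?i (h x) = x"
    using assms(3) by (metis compose_eq restrict_apply')+
qed

text \<open>For a nondegenerate form, \<open>t\<^sub>M\<close> and \<open>t\<^sub>N\<close> are the maps that are \<open>-1\<close> on \<open>M\<close>, \<open>N\<close> and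
  \<open>1\<close> on their annihilators in \<open>E \<bottom> E\<close>.  For degenerate forms these requirements can be
  contradictory, which is why the explicit formulas are taken as definitions.\<close>

lemma t_N_reflection:
  assumes "rational_lattice E f" "h \<in> carrier (isometry_group E f)"
    and nondeg: "\<And>x. \<lbrakk>x \<in> E; \<And>y. y \<in> E \<Longrightarrow> f x y = 0\<rbrakk> \<Longrightarrow> x = 0"
  shows "v \<in> lat_N E h \<Longrightarrow> t_N E f h v = - v"
    and "v \<in> annihilator (E \<times> E) (perp_form f f) (lat_N E h) \<Longrightarrow> t_N E f h v = v"
proof -
  interpret rational_lattice E f by fact
  interpret A: comm_group "additive_group E" by (rule comm_group)
  note inv = isometry_group_inv[OF comm_group assms(2)]
  have add: "x + y \<in> E" if "x \<in> E" "y \<in> E" for x y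
    using A.m_closed[of x y] that by (simp add: additive_group_def)
  show "t_N E f h v = - v" if "v \<in> lat_N E h"
    using that inv by (auto simp: lat_N_def t_N_def)
  assume "v \<in> annihilator (E \<times> E) (perp_form f f) (lat_N E h)"
  then obtain a b where v: "v = (a, b)" and ab: "a \<in> E" "b \<in> E"
    and z: "\<And>x. x \<in> E \<Longrightarrow> f a x + f b (h x) = 0"
    by (fastforce simp: annihilator_def perp_form_def lat_N_def)
  let ?i = "inv\<^bsub>isometry_group E f\<^esub> h"
  have "f (h (?i b)) (h x) = f (?i b) x" if "x \<in> E" for x
    using assms(2) that inv(1)[OF ab(2)] by (simp add: isometry_group_def)
  then have "f (a + ?i b) x = 0" if "x \<in> E" for x
    using z[OF that] that ab inv by (simp add: form_add)
  then have s: "a + ?i b = 0" using nondeg add ab inv(1) by blast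
  then have ai: "a = - ?i b" by (simp add: eq_neg_iff_add_eq_0)
  have "h (a + ?i b) = h a + h (?i b)"
    using assms(2) ab inv(1)
    by (simp add: isometry_group_def AutoGroup_def auto_def additive_group_def hom_def)
  moreover have "h 0 = 0"
  proof -
    have "0 \<in> E" using A.one_closed by (simp add: additive_group_def)
    moreover have "\<forall>x\<in>E. \<forall>y\<in>E. h (x + y) = h x + h y"
      using assms(2) by (simp add: isometry_group_def AutoGroup_def auto_def additive_group_def hom_def)
    ultimately have "h (0 + 0) = h 0 + h 0" by blast
    then show ?thesis by simp
  qed
  ultimately have "h a + b = 0" using s inv(2)[OF ab(2)] by simp
  then have "b = - h a" by (simp add: eq_neg_iff_add_eq_0 add.commute)
  then show "t_N E f h v = v" using ai v by (simp add: t_N_def)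
qed

lemma t_M_reflection:
  assumes "rational_lattice E f"
    and nondeg: "\<And>x. \<lbrakk>x \<in> E; \<And>y. y \<in> E \<Longrightarrow> f x y = 0\<rbrakk> \<Longrightarrow> x = 0"
  shows "v \<in> lat_M E \<Longrightarrow> t_M v = - v"
    and "v \<in> annihilator (E \<times> E) (perp_form f f) (lat_M E) \<Longrightarrow> t_M v = v"
proof -
  interpret rational_lattice E f by fact
  interpret A: comm_group "additive_group E" by (rule comm_group)
  have add: "x + y \<in> E" if "x \<in> E" "y \<in> E" for x y
    using A.m_closed[of x y] that by (simp add: additive_group_def)
  show "t_M v = - v" if "v \<in> lat_M E"
    using that by (auto simp: lat_M_def t_M_def)
  assume "v \<in> annihilator (E \<times> E) (perp_form f f) (lat_M E)"
  then obtain a b where v: "v = (a, b)" and ab: "a \<in> E" "b \<in> E"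
    and z: "\<And>x. x \<in> E \<Longrightarrow> f a x + f b x = 0"
    by (fastforce simp: annihilator_def perp_form_def lat_M_def)
  then have "f (a + b) x = 0" if "x \<in> E" for x
    using that by (simp add: form_add)
  then have "a + b = 0" using nondeg add ab by blast
  then have "a = - b" by (simp add: eq_neg_iff_add_eq_0)
  then show "t_M v = v" using v by (simp add: t_M_def)
qed

lemma group_wreath_Z2:
  assumes "group G"
  shows "group (wreath_Z2 G)"
proof -
  interpret G: group G by fact
  have two: "s = 0 \<or> s = 1" if "0 \<le> s" "s < 2" for s :: int using that by auto
  show ?thesis
  proof (rule groupI)
    fix x assume "x \<in> carrier (wreath_Z2 G)"
    then obtain a b s where x: "x = ((a, b), s)" "a \<in> carrier G" "b \<in> carrier G" "s = 0 \<or> s = 1"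
      using two by (auto simp: wreath_Z2_def semidirect_product_def DirProd_def integer_mod_group_def)
    let ?y = "(if s = 0 then (inv\<^bsub>G\<^esub> a, inv\<^bsub>G\<^esub> b) else (inv\<^bsub>G\<^esub> b, inv\<^bsub>G\<^esub> a), s)"
    have "?y \<in> carrier (wreath_Z2 G)" "?y \<otimes>\<^bsub>wreath_Z2 G\<^esub> x = \<one>\<^bsub>wreath_Z2 G\<^esub>"
      using x by (auto simp: wreath_Z2_def semidirect_product_def DirProd_def integer_mod_group_def)
    then show "\<exists>y\<in>carrier (wreath_Z2 G). y \<otimes>\<^bsub>wreath_Z2 G\<^esub> x = \<one>\<^bsub>wreath_Z2 G\<^esub>" by blast
  qed (auto simp: wreath_Z2_def semidirect_product_def DirProd_def integer_mod_group_def
      G.m_assoc dest!: two)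
qed

end

theory Submission
  imports Defs
begin

text \<open>The sublattice \<open>L\<close> consists of the pairs \<open>(a, b)\<close> with \<open>b - a \<in> (h - 1)E\<close>, so it is an
  equivalence relation on \<open>E\<close>. The isometries \<open>u\<close> of \<open>E\<close> that relate every \<open>x\<close> to \<open>u x\<close> form a
  group \<open>C\<close> containing \<open>h\<close>. For \<open>u, v \<in> C\<close> the map \<open>(a, b) \<mapsto> (u a, v b)\<close> preserves \<open>L\<close>, and
  together with \<open>t\<^sub>M\<close> these maps give an action of \<open>C \<wr> \<int>\<^sub>2\<close> on \<open>L\<close>. It is faithful if
  \<open>E \<noteq> 0\<close>: if some \<open>(a, b) \<mapsto> (- u b, - v a)\<close> were equal to some \<open>(a, b) \<mapsto> (u' a, v' b)\<close>, then
  comparing the values at \<open>(a, a)\<close> and \<open>(a, b)\<close> shows that \<open>L\<close> is the diagonal, hence \<open>C = 1\<close> and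
  \<open>-1 = 1\<close> on \<open>E\<close>. Finally \<open>\<int>\<^sub>n\<close> embeds into \<open>C\<close> by \<open>i \<mapsto> h\<^sup>i\<close>, and \<open>t\<^sub>M\<close> and \<open>t\<^sub>N\<close> are the images
  of \<open>((0, 0), 1)\<close> and \<open>((-1, 1), 1)\<close>.\<close>

section \<open>Wreath products with \<open>\<int>\<^sub>2\<close>\<close>

lemma carrier_wreath_Z2:
  "carrier (wreath_Z2 G) = (carrier G \<times> carrier G) \<times> {0, 1}"
  by (auto simp: wreath_Z2_def semidirect_product_def DirProd_def integer_mod_group_def)

lemma mult_wreath_Z2:
  "((a, b), s) \<otimes>\<^bsub>wreath_Z2 G\<^esub> ((c, d), t) =
     ((a \<otimes>\<^bsub>G\<^esub> (if s = 0 then c else d), b \<otimes>\<^bsub>G\<^esub> (if s = 0 then d else c)), (s + t) mod 2)"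
  by (simp add: wreath_Z2_def semidirect_product_def DirProd_def integer_mod_group_def)

lemma one_wreath_Z2: "\<one>\<^bsub>wreath_Z2 G\<^esub> = ((\<one>\<^bsub>G\<^esub>, \<one>\<^bsub>G\<^esub>), 0)"
  by (simp add: wreath_Z2_def semidirect_product_def DirProd_def integer_mod_group_def)

text \<open>Functoriality of the wreath product: a homomorphism of base groups is applied to both
  coordinates and the \<open>\<int>\<^sub>2\<close> part is kept.\<close>

definition wreath_Z2_map :: "('a \<Rightarrow> 'b) \<Rightarrow> ('a \<times> 'a) \<times> int \<Rightarrow> ('b \<times> 'b) \<times> int" where
  "wreath_Z2_map p = map_prod (map_prod p p) id"

lemma wreath_Z2_map_hom:
  assumes "p \<in> hom G H"
  shows "wreath_Z2_map p \<in> hom (wreath_Z2 G) (wreath_Z2 H)"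
  using assms
  by (auto simp: hom_def wreath_Z2_map_def carrier_wreath_Z2 mult_wreath_Z2 Pi_iff)

lemma inj_on_wreath_Z2_map:
  assumes "inj_on p (carrier G)"
  shows "inj_on (wreath_Z2_map p) (carrier (wreath_Z2 G))"
  using assms by (auto simp: wreath_Z2_map_def carrier_wreath_Z2 inj_on_def)

text \<open>The square of \<open>((a, b), 1)\<close> is
  \<open>((a \<otimes> b, b \<otimes> a), 0)\<close>, so the involutions outside the base group are
  exactly those with \<open>b\<close> inverse to \<open>a\<close>.\<close>

lemma wreathing_involution_swap:
  assumes "group G" "a \<in> carrier G"
  shows "wreathing_involution G ((a, inv\<^bsub>G\<^esub> a), 1)"
proof -
  interpret G: group G by fact
  interpret W: group "wreath_Z2 G" by (rule group_wreath_Z2) fact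
  let ?t = "((a, inv\<^bsub>G\<^esub> a), 1::int)"
  have t: "?t \<in> carrier (wreath_Z2 G)" using assms by (simp add: carrier_wreath_Z2)
  have sq: "?t \<otimes>\<^bsub>wreath_Z2 G\<^esub> ?t = \<one>\<^bsub>wreath_Z2 G\<^esub>"
    using assms by (simp add: mult_wreath_Z2 one_wreath_Z2)
  then have inv: "inv\<^bsub>wreath_Z2 G\<^esub> ?t = ?t" using t by (simp add: W.inv_equality)
  have "?t \<noteq> \<one>\<^bsub>wreath_Z2 G\<^esub>" by (simp add: one_wreath_Z2)
  moreover have "?t [^]\<^bsub>wreath_Z2 G\<^esub> (2::nat) = \<one>\<^bsub>wreath_Z2 G\<^esub>"
    using sq t by (simp add: numeral_2_eq_2)
  ultimately have ord: "group.ord (wreath_Z2 G) ?t = 2"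
    using t W.pow_eq_id[OF t, of 2] W.ord_eq_1[OF t]
    by (metis prime_nat_iff two_is_prime_nat)
  have conj: "?t \<otimes>\<^bsub>wreath_Z2 G\<^esub> ((x, y), 0) \<otimes>\<^bsub>wreath_Z2 G\<^esub> ?t
      = ((a \<otimes>\<^bsub>G\<^esub> y \<otimes>\<^bsub>G\<^esub> inv\<^bsub>G\<^esub> a, inv\<^bsub>G\<^esub> a \<otimes>\<^bsub>G\<^esub> x \<otimes>\<^bsub>G\<^esub> a), 0)" for x y
    by (simp add: mult_wreath_Z2)
  \<comment> \<open>Conjugation by \<open>?t\<close> carries the first factor to the second through
    conjugation by the inverse of \<open>a\<close>, and back through conjugation by
    \<open>a\<close>. Both must be onto.\<close>
  have surj: "\<exists>x\<in>carrier G. y = c \<otimes>\<^bsub>G\<^esub> x \<otimes>\<^bsub>G\<^esub> inv\<^bsub>G\<^esub> c" if "c \<in> carrier G" "y \<in> carrier G" for c y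
    using that by (intro bexI[of _ "inv\<^bsub>G\<^esub> c \<otimes>\<^bsub>G\<^esub> y \<otimes>\<^bsub>G\<^esub> c"])
      (simp_all add: G.m_assoc, simp add: G.m_assoc[symmetric])
  have "(\<lambda>g. ?t \<otimes>\<^bsub>wreath_Z2 G\<^esub> g \<otimes>\<^bsub>wreath_Z2 G\<^esub> ?t) ` first_factor G = second_factor G"
    using assms surj[of "inv\<^bsub>G\<^esub> a"]
    by (auto simp: first_factor_def second_factor_def conj image_iff) blast
  moreover have "(\<lambda>g. ?t \<otimes>\<^bsub>wreath_Z2 G\<^esub> g \<otimes>\<^bsub>wreath_Z2 G\<^esub> ?t) ` second_factor G = first_factor G"
    using assms surj[of a]
    by (auto simp: first_factor_def second_factor_def conj image_iff) blast
  ultimately show ?thesis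
    using t ord by (simp add: wreathing_involution_def inv base_group_def)
qed

section \<open>Lattices and isometries\<close>

lemma mem_isometry_group_iff:
  "g \<in> carrier (isometry_group E f) \<longleftrightarrow> g \<in> extensional E \<and> bij_betw g E E \<and>
     (\<forall>x\<in>E. \<forall>y\<in>E. g (x + y) = g x + g y) \<and> (\<forall>x\<in>E. \<forall>y\<in>E. f (g x) (g y) = f x y)"
  by (auto simp: isometry_group_def AutoGroup_def auto_def Bij_def hom_def additive_group_def
      bij_betw_def)

lemma mult_isometry_group:
  assumes "g \<in> carrier (isometry_group E f)" "k \<in> carrier (isometry_group E f)"
  shows "g \<otimes>\<^bsub>isometry_group E f\<^esub> k = compose E g k"
  using assms
  by (auto simp: isometry_group_def AutoGroup_def auto_def BijGroup_def additive_group_def)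

lemma one_isometry_group: "\<one>\<^bsub>isometry_group E f\<^esub> = (\<lambda>x\<in>E. x)"
  by (simp add: isometry_group_def AutoGroup_def BijGroup_def additive_group_def)

lemma comm_group_additive_groupI:
  assumes "0 \<in> A" "\<And>x y. x \<in> A \<Longrightarrow> y \<in> A \<Longrightarrow> x + y \<in> A" "\<And>x. x \<in> A \<Longrightarrow> - x \<in> A"
  shows "comm_group (additive_group A)"
  using assms by (intro comm_groupI) (auto simp: additive_group_def algebra_simps intro: bexI[of _ "- _"])

context rational_lattice
begin

sublocale A: comm_group "additive_group E"
  by (rule comm_group)

sublocale isometries: group "isometry_group E f"
  by (rule group_isometry_group) (rule comm_group)

lemma zero_mem: "0 \<in> E"
  using A.one_closed by (simp add: additive_group_def)

lemma add_mem: "x \<in> E \<Longrightarrow> y \<in> E \<Longrightarrow> x + y \<in> E"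
  using A.m_closed[of x y] by (simp add: additive_group_def)

lemma uminus_mem: "x \<in> E \<Longrightarrow> - x \<in> E"
  using A.inv_closed[of x] A.r_inv[of x]
  by (auto simp: additive_group_def eq_neg_iff_add_eq_0 add.commute dest: minus_unique)

lemma diff_mem: "x \<in> E \<Longrightarrow> y \<in> E \<Longrightarrow> x - y \<in> E"
  using add_mem[of x "- y"] uminus_mem by simp

text \<open>Freeness of \<open>E\<close> enters here: in a free abelian group the coordinates are
  integers. This later excludes -1 = 1 on a nonzero \<open>E\<close>.\<close>

lemma torsion_free:
  assumes "x \<in> E" "x + x = 0"
  shows "x = 0"
proof -
  obtain r :: nat and p where p: "p \<in> iso (additive_group E) (free_Abelian_group {..<r})"
    using free_fin_rank by (auto simp: is_iso_def)
  have hom: "p (y + z) = p y + p z" if "y \<in> E" "z \<in> E" for y z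
    using p that by (simp add: iso_def hom_def additive_group_def)
  have zero: "p 0 = 0" using hom[of 0 0] zero_mem by simp
  then have "p x + p x = 0" using hom[of x x] assms by simp
  then have "Poly_Mapping.lookup (p x) i + Poly_Mapping.lookup (p x) i = 0" for i
    by (metis lookup_add lookup_zero)
  then have "p x = p 0" by (intro poly_mapping_eqI) (simp add: zero)
  moreover have "inj_on p E"
    using p by (simp add: iso_def bij_betw_def additive_group_def)
  ultimately show ?thesis using assms zero_mem by (auto dest: inj_onD)
qed

text \<open>Additivity is assumed in the first argument only; symmetry moves the sign to the second.
  The lemma is what lets the sign changes in \<open>act\<close> preserve the form.\<close>

lemma form_uminus:
  assumes "x \<in> E" "y \<in> E"
  shows "f (- x) (- y) = f x y"
proof -
  have z: "f 0 u = 0" if "u \<in> E" for u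
    using form_add[of 0 0 u] that zero_mem by simp
  have neg: "f (- u) v = - f u v" if "u \<in> E" "v \<in> E" for u v
    using form_add[of u "- u" v] that uminus_mem z by simp
  show ?thesis
    using assms uminus_mem neg form_sym[of x "- y"] form_sym[of x y] by simp
qed

lemma isometry_mem: "g \<in> carrier (isometry_group E f) \<Longrightarrow> x \<in> E \<Longrightarrow> g x \<in> E"
  by (auto simp: mem_isometry_group_iff bij_betw_def)

lemma isometry_add:
  "g \<in> carrier (isometry_group E f) \<Longrightarrow> x \<in> E \<Longrightarrow> y \<in> E \<Longrightarrow> g (x + y) = g x + g y"
  by (auto simp: mem_isometry_group_iff)

lemma isometry_form:
  "g \<in> carrier (isometry_group E f) \<Longrightarrow> x \<in> E \<Longrightarrow> y \<in> E \<Longrightarrow> f (g x) (g y) = f x y"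
  by (auto simp: mem_isometry_group_iff)

lemma isometry_eq_iff:
  "g \<in> carrier (isometry_group E f) \<Longrightarrow> x \<in> E \<Longrightarrow> y \<in> E \<Longrightarrow> g x = g y \<longleftrightarrow> x = y"
  by (auto simp: mem_isometry_group_iff bij_betw_def dest: inj_onD)

lemma isometry_uminus:
  assumes "g \<in> carrier (isometry_group E f)" "x \<in> E"
  shows "g (- x) = - g x"
proof -
  have "g 0 = 0" using isometry_add[OF assms(1), of 0 0] zero_mem by simp
  then show ?thesis
    using isometry_add[OF assms(1), of "- x" x] assms uminus_mem by (simp add: eq_neg_iff_add_eq_0)
qed

lemma isometry_eqI:
  assumes "g \<in> carrier (isometry_group E f)" "k \<in> carrier (isometry_group E f)"
    and "\<And>x. x \<in> E \<Longrightarrow> g x = k x"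
  shows "g = k"
  using assms by (auto simp: mem_isometry_group_iff intro: extensionalityI)

end

section \<open>The action of the wreath product on \<open>L\<close>\<close>

locale lattice_isometry = rational_lattice +
  fixes h :: "'a \<Rightarrow> 'a"
  assumes h: "h \<in> carrier (isometry_group E f)"
begin

section \<open>The lattice \<open>L\<close> as an equivalence relation on \<open>E\<close>\<close>

abbreviation "O_E \<equiv> isometry_group E f"
abbreviation "L \<equiv> lat_L E h"
abbreviation "O_L \<equiv> isometry_group L (perp_form f f)"

text \<open>In \<open>(x, x) + (y, h y)\<close> the difference of the coordinates is
  \<open>h y - y\<close>; conversely \<open>x = a - y\<close> recovers the summand in
  \<open>M\<close>.\<close>

lemma lat_L_iff: "(a, b) \<in> L \<longleftrightarrow> a \<in> E \<and> b \<in> E \<and> (\<exists>y\<in>E. b - a = h y - y)"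
proof
  assume "(a, b) \<in> L"
  then obtain x y where "x \<in> E" "y \<in> E" "a = x + y" "b = x + h y"
    by (auto simp: lat_L_def lat_M_def lat_N_def elim!: set_plus_elim)
  then show "a \<in> E \<and> b \<in> E \<and> (\<exists>y\<in>E. b - a = h y - y)"
    using add_mem isometry_mem[OF h] by auto
next
  assume "a \<in> E \<and> b \<in> E \<and> (\<exists>y\<in>E. b - a = h y - y)"
  then obtain y where y: "a \<in> E" "y \<in> E" "b = (a - y) + h y"
    by (auto simp: algebra_simps)
  have "(a, b) = (a - y, a - y) + (y, h y)" using y by simp
  moreover have "(a - y, a - y) \<in> lat_M E" "(y, h y) \<in> lat_N E h"
    using y diff_mem by (auto simp: lat_M_def lat_N_def)
  ultimately show "(a, b) \<in> L" unfolding lat_L_def by (metis set_plus_intro)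
qed

lemma lat_L_memD: "(a, b) \<in> L \<Longrightarrow> a \<in> E" "(a, b) \<in> L \<Longrightarrow> b \<in> E"
  by (simp_all add: lat_L_iff)

lemma lat_L_refl: "a \<in> E \<Longrightarrow> (a, a) \<in> L"
  using lat_L_iff zero_mem isometry_uminus[OF h zero_mem] isometry_add[OF h zero_mem zero_mem]
  by (auto intro!: bexI[of _ 0])

lemma lat_L_uminus: "(a, b) \<in> L \<Longrightarrow> (- a, - b) \<in> L"
proof -
  assume "(a, b) \<in> L"
  then obtain y where y: "a \<in> E" "b \<in> E" "y \<in> E" "b - a = h y - y" by (auto simp: lat_L_iff)
  then have "- b - - a = h (- y) - - y" by (simp add: isometry_uminus[OF h] algebra_simps)
  then show ?thesis using y uminus_mem unfolding lat_L_iff by blast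
qed

lemma lat_L_add:
  assumes "(a, b) \<in> L" "(c, d) \<in> L"
  shows "(a + c, b + d) \<in> L"
proof -
  obtain y z where y: "a \<in> E" "b \<in> E" "y \<in> E" "b - a = h y - y"
    and z: "c \<in> E" "d \<in> E" "z \<in> E" "d - c = h z - z"
    using assms by (auto simp: lat_L_iff)
  have "(b + d) - (a + c) = (b - a) + (d - c)" by simp
  also have "\<dots> = h (y + z) - (y + z)"
    unfolding y(4) z(4) using y z by (simp add: isometry_add[OF h])
  finally show ?thesis using y z add_mem unfolding lat_L_iff by blast
qed

text \<open>Since \<open>L\<close> is an additive group containing the diagonal,
  \<open>(b, a) = (a + b, a + b) - (a, b)\<close> lies in it.\<close>

lemma lat_L_sym: "(a, b) \<in> L \<Longrightarrow> (b, a) \<in> L"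
  using lat_L_add[of "a + b" "a + b" "- a" "- b"] lat_L_uminus[of a b] lat_L_refl[of "a + b"]
    add_mem lat_L_memD by simp

text \<open>Here \<open>(a, c) = (a, b) + (b, c) - (b, b)\<close>.\<close>

lemma lat_L_trans: "(a, b) \<in> L \<Longrightarrow> (b, c) \<in> L \<Longrightarrow> (a, c) \<in> L"
  using lat_L_add[OF lat_L_add[of a b b c] lat_L_uminus[OF lat_L_refl[of b]]] lat_L_memD by simp

lemma comm_group_lat_L: "comm_group (additive_group L)"
  by (rule comm_group_additive_groupI)
    (use lat_L_refl[OF zero_mem] lat_L_add lat_L_uminus in \<open>auto simp: zero_prod_def\<close>)

sublocale O_L: group O_L
  by (rule group_isometry_group) (rule comm_group_lat_L)

text \<open>These are the isometries acting trivially on the quotient of \<open>E\<close> by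
  \<open>(h - 1)E\<close>.\<close>

definition C :: "('a \<Rightarrow> 'a) set" where
  "C = {u \<in> carrier O_E. \<forall>x\<in>E. (x, u x) \<in> L}"

lemma C_D: "u \<in> C \<Longrightarrow> u \<in> carrier O_E" "u \<in> C \<Longrightarrow> x \<in> E \<Longrightarrow> (x, u x) \<in> L"
  by (simp_all add: C_def)

lemma h_mem_C: "h \<in> C"
  using h isometry_mem[OF h] by (auto simp: C_def lat_L_iff)

lemma subgroup_C: "subgroup C O_E"
proof (rule isometries.subgroupI)
  show "C \<subseteq> carrier O_E" by (auto simp: C_def)
  show "C \<noteq> {}" using h_mem_C by blast
next
  fix u assume u: "u \<in> C"
  note inv = isometry_group_inv[OF comm_group C_D(1)[OF u]]
  have "(x, (inv\<^bsub>O_E\<^esub> u) x) \<in> L" if "x \<in> E" for x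
    using C_D(2)[OF u inv(1)[OF that]] inv(2)[OF that] lat_L_sym by simp
  then show "inv\<^bsub>O_E\<^esub> u \<in> C"
    using C_D(1)[OF u] by (simp add: C_def)
next
  fix u v assume u: "u \<in> C" and v: "v \<in> C"
  have "u \<otimes>\<^bsub>O_E\<^esub> v \<in> carrier O_E" using u v C_D(1) by simp
  moreover have "(x, (u \<otimes>\<^bsub>O_E\<^esub> v) x) \<in> L" if "x \<in> E" for x
    using lat_L_trans[OF C_D(2)[OF v that] C_D(2)[OF u]] isometry_mem[OF C_D(1)[OF v] that]
      C_D(1)[OF u] C_D(1)[OF v] that
    by (simp add: mult_isometry_group compose_eq)
  ultimately show "u \<otimes>\<^bsub>O_E\<^esub> v \<in> C" by (simp add: C_def)
qed

text \<open>Transitivity along the chain \<open>u a\<close>, \<open>a\<close>, \<open>b\<close>,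
  \<open>v b\<close>.\<close>

lemma C_lat_L:
  assumes "u \<in> C" "v \<in> C" "(a, b) \<in> L"
  shows "(u a, v b) \<in> L"
  using lat_L_sym[OF C_D(2)[OF assms(1) lat_L_memD(1)[OF assms(3)]]] assms(3)
    C_D(2)[OF assms(2) lat_L_memD(2)[OF assms(3)]]
  by (rule lat_L_trans[OF lat_L_trans])

text \<open>The second case is \<open>t\<^sub>M\<close> followed by \<open>(u, v)\<close>.
  Restricting to \<open>L\<close> makes the values extensional, as elements of \<open>O_L\<close>
  must be.\<close>

definition act :: "(('a \<Rightarrow> 'a) \<times> ('a \<Rightarrow> 'a)) \<times> int \<Rightarrow> 'a \<times> 'a \<Rightarrow> 'a \<times> 'a" where
  "act = (\<lambda>((u, v), s). \<lambda>(a, b)\<in>L. if s = 0 then (u a, v b) else (- u b, - v a))"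

lemma act_apply:
  "(a, b) \<in> L \<Longrightarrow> act ((u, v), s) (a, b) = (if s = 0 then (u a, v b) else (- u b, - v a))"
  by (simp add: act_def)

lemma act_mem:
  assumes u: "u \<in> C" and v: "v \<in> C"
  shows "act ((u, v), s) \<in> carrier O_L"
proof -
  note [simp] = isometry_add[OF C_D(1)] isometry_form[OF C_D(1)] isometry_eq_iff[OF C_D(1)]
    isometry_mem[OF C_D(1)]
  let ?g = "act ((u, v), s)"
  have mem: "?g (a, b) \<in> L" if "(a, b) \<in> L" for a b
    using that u v C_lat_L lat_L_sym lat_L_uminus by (simp add: act_apply)
  have inj: "inj_on ?g L"
    using u v by (intro inj_onI) (auto simp: act_apply lat_L_memD split: if_splits)
  have surj: "\<exists>p\<in>L. ?g p = (c, d)" if cd: "(c, d) \<in> L" for c d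
  proof -
    let ?i = "\<lambda>w. inv\<^bsub>O_E\<^esub> w"
    have i: "?i u \<in> C" "?i v \<in> C"
      using u v subgroup.m_inv_closed[OF subgroup_C] by auto
    have canc: "w (?i w x) = x" if "w \<in> C" "x \<in> E" for w x
      using isometry_group_inv[OF comm_group C_D(1)] that by blast
    have E: "c \<in> E" "d \<in> E" using cd lat_L_memD by auto
    show ?thesis
    proof (cases "s = 0")
      case True
      have "(?i u c, ?i v d) \<in> L" using i cd C_lat_L by blast
      then show ?thesis using True u v E canc
        by (intro bexI[of _ "(?i u c, ?i v d)"]) (auto simp: act_apply)
    next
      case False
      \<comment> \<open>The preimage comes from solving \<open>- u b = c\<close> and
        \<open>- v a = d\<close>, which exchanges the coordinates.\<close>
      have "(?i v (- d), ?i u (- c)) \<in> L" using i cd C_lat_L lat_L_sym lat_L_uminus by blast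
      then show ?thesis
        using False canc[OF u uminus_mem[OF E(1)]] canc[OF v uminus_mem[OF E(2)]]
        by (intro bexI[of _ "(?i v (- d), ?i u (- c))"]) (auto simp: act_apply)
    qed
  qed
  have "?g ` L = L"
  proof
    show "?g ` L \<subseteq> L" using mem by (metis image_subsetI surj_pair)
    show "L \<subseteq> ?g ` L" using surj by (metis image_eqI subsetI surj_pair)
  qed
  moreover have "?g (p + q) = ?g p + ?g q" if "p \<in> L" "q \<in> L" for p q
    using that u v lat_L_add by (cases p; cases q) (auto simp: act_apply lat_L_memD)
  moreover have "perp_form f f (?g p) (?g q) = perp_form f f p q" if "p \<in> L" "q \<in> L" for p q
    using that u v
    by (cases p; cases q) (auto simp: act_apply lat_L_memD perp_form_def form_uminus)
  ultimately show ?thesis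
    using inj by (auto simp: mem_isometry_group_iff bij_betw_def act_def)
qed

text \<open>Moving \<open>t\<^sub>M\<close> past \<open>(u', v')\<close> turns it into
  \<open>(v', u')\<close>, which is the swap in the multiplication of the wreath product.\<close>

lemma act_hom: "act \<in> hom (wreath_Z2 (O_E\<lparr>carrier := C\<rparr>)) O_L"
proof (rule homI)
  fix p assume "p \<in> carrier (wreath_Z2 (O_E\<lparr>carrier := C\<rparr>))"
  then show "act p \<in> carrier O_L"
    by (auto simp: carrier_wreath_Z2 intro!: act_mem)
next
  fix p q assume pq: "p \<in> carrier (wreath_Z2 (O_E\<lparr>carrier := C\<rparr>))"
    "q \<in> carrier (wreath_Z2 (O_E\<lparr>carrier := C\<rparr>))"
  then obtain u v s u' v' s' where p: "p = ((u, v), s)" "u \<in> C" "v \<in> C" "s = 0 \<or> s = 1"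
    and q: "q = ((u', v'), s')" "u' \<in> C" "v' \<in> C" "s' = 0 \<or> s' = 1"
    by (auto simp: carrier_wreath_Z2)
  have "act (p \<otimes>\<^bsub>wreath_Z2 (O_E\<lparr>carrier := C\<rparr>)\<^esub> q) = compose L (act p) (act q)"
  proof (rule extensionalityI[of _ L])
    fix z assume "z \<in> L"
    then obtain a b where z: "z = (a, b)" "(a, b) \<in> L" by (cases z) auto
    \<comment> \<open>These are the values of \<open>act q\<close> for \<open>s' = 0\<close> and
      \<open>s' = 1\<close>; they must lie in \<open>L\<close> before \<open>act p\<close> can be
      evaluated on them.\<close>
    have 1: "(u' a, v' b) \<in> L" using q z C_lat_L by blast
    have 2: "(- u' b, - v' a) \<in> L" using q z C_lat_L lat_L_uminus lat_L_sym by blast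
    show "act (p \<otimes>\<^bsub>wreath_Z2 (O_E\<lparr>carrier := C\<rparr>)\<^esub> q) z = compose L (act p) (act q) z"
      using p q z 1 2
      by (auto simp: compose_eq act_apply mult_wreath_Z2 mult_isometry_group C_D lat_L_memD
          isometry_uminus isometry_mem)
  qed (auto simp: act_def p(1) q(1) mult_wreath_Z2)
  also have "\<dots> = act p \<otimes>\<^bsub>O_L\<^esub> act q"
    using p q act_mem by (simp add: mult_isometry_group)
  finally show "act (p \<otimes>\<^bsub>wreath_Z2 (O_E\<lparr>carrier := C\<rparr>)\<^esub> q) = act p \<otimes>\<^bsub>O_L\<^esub> act q" .
qed

text \<open>For \<open>E = {0}\<close> both sides would be the same map on the one-point lattice
  \<open>L\<close>, hence the first hypothesis.\<close>

lemma act_rotation_neq_reflection: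
  assumes "E \<noteq> {0}" "u \<in> C" "v \<in> C" "u' \<in> C"
  shows "act ((u, v), 0) \<noteq> act ((u', v'), 1)"
proof
  assume "act ((u, v), 0) = act ((u', v'), 1)"
  then have eq: "u a = - u' b" if "(a, b) \<in> L" for a b
    using act_apply[OF that, of u v 0] act_apply[OF that, of u' v' 1] by simp
  \<comment> \<open>Both \<open>(a, b)\<close> and \<open>(a, a)\<close> lie in \<open>L\<close>, so
    \<open>- u' b = u a = - u' a\<close>, and \<open>u'\<close> is injective.\<close>
  have diag: "a = b" if "(a, b) \<in> L" for a b
    using eq[OF that] eq[OF lat_L_refl[of a]] isometry_eq_iff[OF C_D(1)[OF assms(4)]] lat_L_memD that
    by (metis neg_equal_iff_equal)
  have "a = 0" if "a \<in> E" for a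
  proof (rule torsion_free[OF that])
    have "u a = a" "u' a = a" using diag C_D(2) assms that by metis+
    then have "a = - a" using eq[OF lat_L_refl[OF that]] by simp
    then show "a + a = 0" by (simp add: eq_neg_iff_add_eq_0)
  qed
  then show False using assms(1) zero_mem by blast
qed

lemma inj_on_act:
  assumes "E \<noteq> {0}"
  shows "inj_on act (carrier (wreath_Z2 (O_E\<lparr>carrier := C\<rparr>)))"
proof -
  have "u = u' \<and> v = v' \<and> s = s'"
    if m: "u \<in> C" "v \<in> C" "u' \<in> C" "v' \<in> C" "s = 0 \<or> s = 1" "s' = 0 \<or> s' = 1"
    and eq: "act ((u, v), s) = act ((u', v'), s')" for u v u' v' s s'
  proof -
    have s: "s = s'"
      using m eq act_rotation_neq_reflection[OF assms] by metis
    \<comment> \<open>The diagonal lies in \<open>L\<close>, and the two coordinates at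
      \<open>(x, x)\<close> reveal \<open>u x\<close> and \<open>v x\<close> up to a common sign
      determined by \<open>s\<close>.\<close>
    have "u x = u' x \<and> v x = v' x" if "x \<in> E" for x
      using fun_cong[OF eq, of "(x, x)"] act_apply[OF lat_L_refl[OF that]] s
      by (auto split: if_splits)
    then show ?thesis using s m C_D(1) isometry_eqI by metis
  qed
  then show ?thesis by (fastforce simp: inj_on_def carrier_wreath_Z2)
qed

section \<open>Powers of \<open>h\<close>\<close>

lemma pow_hom:
  "(\<lambda>i. h [^]\<^bsub>O_E\<^esub> i) \<in> hom (integer_mod_group (group.ord O_E h)) (O_E\<lparr>carrier := C\<rparr>)"
proof (rule homI)
  fix i :: int
  show "h [^]\<^bsub>O_E\<^esub> i \<in> carrier (O_E\<lparr>carrier := C\<rparr>)"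
    using isometries.subgroup_int_pow_closed[OF subgroup_C h_mem_C] by simp
next
  fix i j :: int
  let ?n = "int (group.ord O_E h)"
  \<comment> \<open>This formula also covers infinite order, where \<open>group.ord\<close> is 0:
    \<open>integer_mod_group 0\<close> is the group of integers and reduction modulo 0 is the
    identity.\<close>
  have "i \<otimes>\<^bsub>integer_mod_group (group.ord O_E h)\<^esub> j = (i + j) mod ?n"
    by (simp add: integer_mod_group_def integer_group_def)
  moreover have "h [^]\<^bsub>O_E\<^esub> ((i + j) mod ?n) = h [^]\<^bsub>O_E\<^esub> (i + j)"
    using isometries.int_pow_eq[OF h] by (simp add: mod_eq_dvd_iff[symmetric])
  ultimately show "h [^]\<^bsub>O_E\<^esub> (i \<otimes>\<^bsub>integer_mod_group (group.ord O_E h)\<^esub> j)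
      = h [^]\<^bsub>O_E\<^esub> i \<otimes>\<^bsub>O_E\<lparr>carrier := C\<rparr>\<^esub> h [^]\<^bsub>O_E\<^esub> j"
    using isometries.int_pow_mult[OF h] by simp
qed

lemma inj_on_pow:
  "inj_on (\<lambda>i. h [^]\<^bsub>O_E\<^esub> i) (carrier (integer_mod_group (group.ord O_E h)))"
proof (rule inj_onI)
  fix i j :: int
  let ?n = "int (group.ord O_E h)"
  assume ij: "i \<in> carrier (integer_mod_group (group.ord O_E h))"
    "j \<in> carrier (integer_mod_group (group.ord O_E h))" and "h [^]\<^bsub>O_E\<^esub> i = h [^]\<^bsub>O_E\<^esub> j"
  then have "j mod ?n = i mod ?n"
    using isometries.int_pow_eq[OF h] by (simp add: mod_eq_dvd_iff)
  then show "i = j" using ij by (auto simp: integer_mod_group_def split: if_splits)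
qed

end

section \<open>Embedding the wreath product of \<open>\<int>\<^sub>n\<close> into the isometry group
  of \<open>L\<close>\<close>

theorem theorem1p2:
  fixes E :: "'a::ab_group_add set" and f :: "'a \<Rightarrow> 'a \<Rightarrow> rat"
    and h :: "'a \<Rightarrow> 'a" and n :: nat
  defines "OL \<equiv> isometry_group (lat_L E h) (perp_form f f)"
    and "tM \<equiv> restrict t_M (lat_L E h)"
    and "tN \<equiv> restrict (t_N E f h) (lat_L E h)"
  assumes "integral_lattice E f"
    and "E \<noteq> {0}"
    and "h \<in> carrier (isometry_group E f)"
    and "n > 0"
    and "group.ord (isometry_group E f) h = n"
  shows "\<exists>W \<phi>. subgroup W OL
      \<and> subgroup (generate OL {tM, tN}) (OL\<lparr>carrier := W\<rparr>)
      \<and> \<phi> \<in> iso (OL\<lparr>carrier := W\<rparr>) (wreath_Z2 (integer_mod_group n))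
      \<and> wreathing_involution (integer_mod_group n) (\<phi> tM)
      \<and> wreathing_involution (integer_mod_group n) (\<phi> tN)"
proof -
  interpret integral_lattice E f by fact
  interpret lattice_isometry E f h by unfold_locales fact
  let ?Z = "integer_mod_group n"
  let ?p = "\<lambda>i::int. h [^]\<^bsub>O_E\<^esub> i"
  interpret Z: group ?Z by (rule group_integer_mod_group)
  interpret Wr: group "wreath_Z2 ?Z" by (rule group_wreath_Z2) (rule Z.is_group)
  define \<psi> where "\<psi> = act \<circ> wreath_Z2_map ?p"
  have hom_map: "wreath_Z2_map ?p \<in> hom (wreath_Z2 ?Z) (wreath_Z2 (O_E\<lparr>carrier := C\<rparr>))"
    using wreath_Z2_map_hom[OF pow_hom] assms(8) by simp
  have hom: "\<psi> \<in> hom (wreath_Z2 ?Z) OL"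
    unfolding \<psi>_def OL_def by (rule hom_compose[OF hom_map act_hom])
  have inj: "inj_on \<psi> (carrier (wreath_Z2 ?Z))"
    unfolding \<psi>_def
  proof (rule comp_inj_on)
    show "inj_on (wreath_Z2_map ?p) (carrier (wreath_Z2 ?Z))"
      using inj_on_wreath_Z2_map[OF inj_on_pow] assms(8) by simp
    show "inj_on act (wreath_Z2_map ?p ` carrier (wreath_Z2 ?Z))"
      using inj_on_act[OF assms(5)] hom_carrier[OF hom_map] by (rule inj_on_subset)
  qed
  interpret OL: group OL unfolding OL_def by (rule O_L.is_group)
  interpret \<psi>: group_hom "wreath_Z2 ?Z" OL \<psi> by unfold_locales (rule hom)
  \<comment> \<open>The group \<open>W\<close> is the image of the embedding \<open>\<psi>\<close>,
    and \<open>\<phi>\<close> will be its inverse, so properties of \<open>\<phi> tM\<close> and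
    \<open>\<phi> tN\<close> can be checked on preimages.\<close>
  define W where "W = \<psi> ` carrier (wreath_Z2 ?Z)"
  define \<phi> where "\<phi> = inv_into (carrier (wreath_Z2 ?Z)) \<psi>"
  have W: "subgroup W OL" unfolding W_def by (rule \<psi>.img_is_subgroup)
  have "\<psi> \<in> iso (wreath_Z2 ?Z) (OL\<lparr>carrier := W\<rparr>)"
    using hom inj by (auto simp: iso_def hom_def W_def bij_betw_def)
  then have iso: "\<phi> \<in> iso (OL\<lparr>carrier := W\<rparr>) (wreath_Z2 ?Z)"
    using Wr.iso_set_sym by (fastforce simp: \<phi>_def W_def)
  have swap: "\<psi> t \<in> W \<and> wreathing_involution ?Z (\<phi> (\<psi> t))"
    if "t = ((a, inv\<^bsub>?Z\<^esub> a), 1)" "a \<in> carrier ?Z" for t a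
  proof -
    have "wreathing_involution ?Z t" using that wreathing_involution_swap[OF Z.is_group] by simp
    moreover from this have "t \<in> carrier (wreath_Z2 ?Z)" by (simp add: wreathing_involution_def)
    ultimately show ?thesis by (simp add: W_def \<phi>_def inv_into_f_f[OF inj])
  qed
  define tm where "tm = (((0, inv\<^bsub>?Z\<^esub> 0), 1) :: (int \<times> int) \<times> int)"
  \<comment> \<open>Reduction modulo \<open>n\<close> matters for \<open>n = 1\<close>, where 1
    itself is not in the carrier.\<close>
  define b where "b = 1 mod int n"
  \<comment> \<open>The formula for \<open>t\<^sub>N\<close> has the inverse of \<open>h\<close> in
    its first coordinate and \<open>h\<close> in its second. The double inverse matches the shape
    required by \<open>swap\<close>.\<close>
  define tn where "tn = ((inv\<^bsub>?Z\<^esub> b, inv\<^bsub>?Z\<^esub> (inv\<^bsub>?Z\<^esub> b)), 1::int)"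
  have b: "b \<in> carrier ?Z" using assms(7) by (simp add: b_def carrier_integer_mod_group)
  have hb: "?p b = h"
  proof -
    have "?p b = ?p 1"
      using isometries.int_pow_eq[OF h] assms(8) by (simp add: b_def mod_eq_dvd_iff[symmetric])
    then show ?thesis using isometries.int_pow_1[OF h] by simp
  qed
  have hib: "?p (inv\<^bsub>?Z\<^esub> b) = inv\<^bsub>O_E\<^esub> h"
  proof -
    have "?p (inv\<^bsub>?Z\<^esub> b) = ?p (- b)"
      using isometries.int_pow_eq[OF h] assms(7,8) b
      by (simp add: inv_integer_mod_group mod_eq_dvd_iff[symmetric])
    then show ?thesis using isometries.int_pow_neg[OF h] hb by simp
  qed
  have zero: "(0::int) \<in> carrier ?Z" "inv\<^bsub>?Z\<^esub> 0 = (0::int)"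
    using Z.one_closed Z.inv_one by simp_all
  have "\<psi> tm = tM"
    using zero(2) unfolding \<psi>_def tm_def tM_def wreath_Z2_map_def
    by (auto simp: act_def t_M_def one_isometry_group restrict_def fun_eq_iff lat_L_memD)
  moreover have "\<psi> tn = tN"
    unfolding \<psi>_def tn_def tN_def wreath_Z2_map_def Z.inv_inv[OF b] comp_def map_prod_simp hb hib
    by (simp add: act_def t_N_def)
  ultimately have tM: "tM \<in> W" "wreathing_involution ?Z (\<phi> tM)"
    and tN: "tN \<in> W" "wreathing_involution ?Z (\<phi> tN)"
    using swap[OF tm_def zero(1)] swap[OF tn_def Z.inv_closed[OF b]] by simp_all
  have "generate OL {tM, tN} \<subseteq> W" using OL.generate_subgroup_incl[OF _ W] tM tN by simp
  moreover have "subgroup (generate OL {tM, tN}) OL"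
    using subgroup.subset[OF W] tM(1) tN(1) by (intro OL.generate_is_subgroup) auto
  ultimately have "subgroup (generate OL {tM, tN}) (OL\<lparr>carrier := W\<rparr>)"
    using OL.subgroup_incl W by blast
  then show ?thesis using W iso tM tN by blast
qed

end
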